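(* Let $\star\in\{*,T\}$ and let $L(\lambda)=\lambda M+K\in\mathbb{C}^{2n\times 2n}[\lambda]$ be a regular $\star$-skew-Hamiltonian/Hamiltonian (SHH) pencil. Let $(X_c,\Lambda_c)$ and $(X_f,\Lambda_f)$ be complementary deflating pairs of $L(\lambda)$, where $\Lambda_c\in\mathbb{C}^{p\times p}$. Suppose that (a) $\sigma(\Lambda_c)\cap\sigma(-\Lambda_f^\star)=\emptyset$, and (b) $G:=X_c^\star JMX_c$ is nonsingular. Let $\Lambda_a,\hat M,\hat K\in\mathbb{C}^{p\times p}$ be such that $$\hat M\Lambda_a+\hat K=G(\Lambda_c-\Lambda_a).$$ Set $$\Delta M:=J^\star U\hat MU^\star,\qquad \Delta K:=J^\star U\hat KU^\star,\qquad\text{where } U:=JMX_cG^{-1}.$$ Then $(X_c,\Lambda_a)$ and $(X_f,\Lambda_f)$ are complementary deflating pairs of the pencil $L_\Delta(\lambda)=\lambda(M+\Delta M)+(K+\Delta K)$. Furthermore, $L_\Delta(\lambda)$ is a $\star$-SHH pencil whenever $\lambda\hat M+\hat K\in\mathbb{L}_p(\star,-1,1)$. The latter holds if and only if $\lambda\hat M+(\hat M+G)\Lambda_a\in\mathbb{L}_p(\star,-1,1)$.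
   Context: $J=\begin{bmatrix}0&I_n\\-I_n&0\end{bmatrix}$. For $\star\in\{*,T\}$ (conjugate transpose or transpose), a pencil $\lambda M+K\in\mathbb{C}^{2n\times2n}[\lambda]$ is $\star$-skew-Hamiltonian/Hamiltonian ($\star$-SHH) if $(JM)^\star=-JM$ and $(JK)^\star=JK$. $\mathbb{L}_p(\star,-1,1)$ is the set of pencils $\lambda A+B\in\mathbb{C}^{p\times p}[\lambda]$ with $A^\star=-A$ and $B^\star=B$. A pencil $\lambda M+K$ is regular if $\det(\lambda M+K)$ is not the zero polynomial. A deflating pair of a pencil $\lambda M+K\in\mathbb{C}^{N\times N}[\lambda]$ is a matrix pair $(X,\Lambda)\in\mathbb{C}^{N\times p}\times\mathbb{C}^{p\times p}$ with $\operatorname{rank}X=p\le N$ and $MX\Lambda+KX=0$ ($\Lambda$ need not be diagonal). Two deflating pairs $(X_1,\Lambda_1)$, $(X_2,\Lambda_2)$ are complementary if $[X_1\ X_2]$ is a nonsingular square matrix. $\sigma(\Lambda)$ is the spectrum of $\Lambda$. *)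

theory Defs
  imports
    "Jordan_Normal_Form.Schur_Decomposition"
    "Jordan_Normal_Form.Spectral_Radius"
    "Jordan_Normal_Form.DL_Rank"
    "Jordan_Normal_Form.Gauss_Jordan_Elimination"
begin

(* The pair (M, K) stands for the pencil \<lambda> M + K. *)
type_synonym pencil = "complex mat \<times> complex mat"

fun pencil_poly_mat :: "pencil \<Rightarrow> complex poly mat" where
  "pencil_poly_mat (M, K) =
     [:0, 1:] \<cdot>\<^sub>m map_mat (\<lambda>a. [:a:]) M + map_mat (\<lambda>a. [:a:]) K"

definition regular_pencil :: "pencil \<Rightarrow> bool" where
  "regular_pencil L \<longleftrightarrow> det (pencil_poly_mat L) \<noteq> 0"

definition J_mat :: "nat \<Rightarrow> complex mat" where
  "J_mat n = four_block_mat (0\<^sub>m n n) (1\<^sub>m n) (- 1\<^sub>m n) (0\<^sub>m n n)"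

(* In the following, star is either mat_adjoint or transpose_mat. *)

fun SHH_pencil :: "(complex mat \<Rightarrow> complex mat) \<Rightarrow> nat \<Rightarrow> pencil \<Rightarrow> bool" where
  "SHH_pencil star n (M, K) \<longleftrightarrow>
     M \<in> carrier_mat (2 * n) (2 * n) \<and> K \<in> carrier_mat (2 * n) (2 * n) \<and>
     star (J_mat n * M) = - (J_mat n * M) \<and>
     star (J_mat n * K) = J_mat n * K"

(* The set L_p(star, -1, 1). *)
definition structured_pencils :: "nat \<Rightarrow> (complex mat \<Rightarrow> complex mat) \<Rightarrow> pencil set" where
  "structured_pencils p star =
     {(A, B). A \<in> carrier_mat p p \<and> B \<in> carrier_mat p p \<and> star A = - A \<and> star B = B}"

fun deflating_pair :: "nat \<Rightarrow> nat \<Rightarrow> pencil \<Rightarrow> complex mat \<times> complex mat \<Rightarrow> bool" where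
  "deflating_pair N p (M, K) (X, \<Lambda>) \<longleftrightarrow>
     M \<in> carrier_mat N N \<and> K \<in> carrier_mat N N \<and>
     X \<in> carrier_mat N p \<and> \<Lambda> \<in> carrier_mat p p \<and>
     vec_space.rank N X = p \<and> p \<le> N \<and>
     M * X * \<Lambda> + K * X = 0\<^sub>m N p"

(* The block row [A B]; column analogue of append_rows. *)
definition append_cols :: "complex mat \<Rightarrow> complex mat \<Rightarrow> complex mat" where
  "append_cols A B = four_block_mat A B (0\<^sub>m 0 (dim_col A)) (0\<^sub>m 0 (dim_col B))"

(* invertible_mat includes squareness, hence forces p + q = N. *)
definition complementary_deflating_pairs ::
  "nat \<Rightarrow> nat \<Rightarrow> nat \<Rightarrow> pencil \<Rightarrow> complex mat \<times> complex mat \<Rightarrow> complex mat \<times> complex mat \<Rightarrow> bool" where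
  "complementary_deflating_pairs N p q L P1 P2 \<longleftrightarrow>
     deflating_pair N p L P1 \<and> deflating_pair N q L P2 \<and>
     invertible_mat (append_cols (fst P1) (fst P2))"

end

theory Submission
  imports Defs
begin

text \<open>
Multiplying by \<open>J\<close> turns the pencil into \<open>\<lambda> A + B\<close> with \<open>A = J M\<close> skew and \<open>B = J K\<close> symmetric with
respect to \<open>star\<close>, and leaves the deflating pairs as they are. Everything rests on the
\<open>A\<close>-orthogonality of the two invariant blocks. Taking \<open>star\<close> of the equation for
\<open>X\<^sub>f\<close> and comparing it with the one for \<open>X\<^sub>c\<close>, the matrix \<open>W = star X\<^sub>f * A * X\<^sub>c\<close> satisfies the
Sylvester equation \<open>W * \<Lambda>\<^sub>c = - star \<Lambda>\<^sub>f * W\<close>, which has only the zero solution if the spectra of its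
coefficients are disjoint (\<open>sylvester_homogeneous_zero\<close>, \<open>deflating_orthogonal\<close>).

Since \<open>A\<close> and \<open>G = star X\<^sub>c * A * X\<^sub>c\<close> are both skew, \<open>star U\<close> equals the inverse of \<open>G\<close> times
\<open>star X\<^sub>c * A\<close>. Hence \<open>star U * X\<^sub>c\<close> is the identity, and the orthogonality says that
\<open>star U * X\<^sub>f = 0\<close>. The updates, which contain \<open>star U\<close> as a right factor, are thus invisible on \<open>X\<^sub>f\<close>
(\<open>deflating_pair_preserved\<close>), while on \<open>X\<^sub>c\<close> the condition on \<open>Mh\<close> and \<open>Kh\<close> is the one that exchanges
\<open>\<Lambda>\<^sub>c\<close> for \<open>\<Lambda>\<^sub>a\<close> (\<open>deflating_pair_replaced\<close>). The matrices \<open>X\<^sub>c\<close>, \<open>X\<^sub>f\<close> do not change, so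
complementarity survives.

The structure is preserved because \<open>J\<close> times an update is the congruence \<open>U * Mh * star U\<close> or
\<open>U * Kh * star U\<close> (\<open>SHH_update\<close>). For the last equivalence, the condition on \<open>Mh\<close> and \<open>Kh\<close> reads
\<open>Kh + (Mh + G) * \<Lambda>\<^sub>a = G * \<Lambda>\<^sub>c\<close>, and \<open>G * \<Lambda>\<^sub>c = - star X\<^sub>c * B * X\<^sub>c\<close> is symmetric with respect to \<open>star\<close>.
\<close>

section \<open>Transpose and conjugate transpose as matrix involutions\<close>

lemma adjoint_index:
  "i < dim_col A \<Longrightarrow> j < dim_row A \<Longrightarrow> mat_adjoint A $$ (i, j) = cnj (A $$ (j, i))"
  unfolding mat_adjoint_def by (simp add: mat_of_rows_index conjugate_complex_def)

lemma adjoint_dim [simp]: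
  "dim_row (mat_adjoint A) = dim_col A" "dim_col (mat_adjoint A) = dim_row A"
  unfolding mat_adjoint_def by auto

lemma adjoint_mult:
  assumes "dim_col A = dim_row B"
  shows "mat_adjoint (A * B) = mat_adjoint B * mat_adjoint (A :: complex mat)"
proof (rule eq_matI)
  fix i j
  assume "i < dim_row (mat_adjoint B * mat_adjoint A)"
    and "j < dim_col (mat_adjoint B * mat_adjoint A)"
  then have i: "i < dim_col B" and j: "j < dim_row A" by auto
  have "mat_adjoint (A * B) $$ (i, j) = (\<Sum>k<dim_row B. cnj (A $$ (j, k)) * cnj (B $$ (k, i)))"
    using i j assms by (simp add: adjoint_index scalar_prod_def atLeast0LessThan)
  also have "\<dots> = (\<Sum>k<dim_row B. mat_adjoint B $$ (i, k) * mat_adjoint A $$ (k, j))"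
    using i j assms by (intro sum.cong) (simp_all add: adjoint_index mult.commute)
  also have "\<dots> = (mat_adjoint B * mat_adjoint A) $$ (i, j)"
    using i j assms by (simp add: scalar_prod_def atLeast0LessThan)
  finally show "mat_adjoint (A * B) $$ (i, j) = (mat_adjoint B * mat_adjoint A) $$ (i, j)" .
qed auto

text \<open>Associativity with side conditions on dimensions only, so that the simplifier can discharge them
  for rectangular factors without guessing the inner dimensions.\<close>

lemma mult_assoc_dim:
  "dim_col A = dim_row B \<Longrightarrow> dim_col B = dim_row C \<Longrightarrow> A * B * C = A * (B * (C :: 'a :: semiring_0 mat))"
  by (rule assoc_mult_mat) auto

locale mat_star =
  fixes star :: "complex mat \<Rightarrow> complex mat"
  assumes star: "star \<in> {mat_adjoint, transpose_mat}"
begin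

lemma dim_star [simp]: "dim_row (star A) = dim_col A" "dim_col (star A) = dim_row A"
  using star by auto

lemma star_carrier [simp]: "A \<in> carrier_mat a b \<Longrightarrow> star A \<in> carrier_mat b a"
  by auto

lemma star_star [simp]: "star (star A) = A"
  using star by (auto intro!: eq_matI simp: adjoint_index)

lemma star_mult: "dim_col A = dim_row B \<Longrightarrow> star (A * B) = star B * star A"
  using star adjoint_mult[of A B]
  by (auto intro: transpose_mult[of A "dim_row A" "dim_row B" B "dim_col B"])

lemma star_uminus: "star (- A) = - star A"
  using star by (auto intro!: eq_matI simp: adjoint_index)

lemma star_add:
  "dim_row A = dim_row B \<Longrightarrow> dim_col A = dim_col B \<Longrightarrow> star (A + B) = star A + star B"
  using star by (auto intro!: eq_matI simp: adjoint_index)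

lemma star_diff:
  "dim_row A = dim_row B \<Longrightarrow> dim_col A = dim_col B \<Longrightarrow> star (A - B) = star A - star B"
  using star by (auto intro!: eq_matI simp: adjoint_index)

lemma star_zero: "star (0\<^sub>m a b) = 0\<^sub>m b a"
  using star by (auto intro!: eq_matI simp: adjoint_index)

lemma star_one: "star (1\<^sub>m a) = 1\<^sub>m a"
  using star by (auto intro!: eq_matI simp: adjoint_index)

lemma star_J: "star (J_mat n) = - J_mat n"
  using star by (auto intro!: eq_matI simp: adjoint_index J_mat_def)

end

lemma J_carrier: "J_mat n \<in> carrier_mat (2 * n) (2 * n)"
  unfolding J_mat_def by auto

lemma J_square: "J_mat n * J_mat n = - 1\<^sub>m (2 * n)"
proof -
  have "J_mat n * J_mat n = four_block_mat (- 1\<^sub>m n) (0\<^sub>m n n) (0\<^sub>m n n) (- 1\<^sub>m n)"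
    unfolding J_mat_def by (subst mult_four_block_mat[of _ n n _ n _ n _ _ n _ n]) auto
  also have "\<dots> = - 1\<^sub>m (2 * n)"
    by (rule eq_matI) auto
  finally show ?thesis .
qed

section \<open>The homogeneous Sylvester equation\<close>

text \<open>After a change of basis that makes \<open>A\<close> upper triangular, the columns of the solution vanish one
  after another: once those before column \<open>j\<close> are zero, column \<open>j\<close> satisfies the eigenvector equation of
  \<open>B\<close> for the \<open>j\<close>-th diagonal entry, which is an eigenvalue of \<open>A\<close> and hence not one of \<open>B\<close>.\<close>

lemma sylvester_homogeneous_zero:
  fixes A B W :: "complex mat"
  assumes A: "A \<in> carrier_mat p p" and B: "B \<in> carrier_mat q q" and W: "W \<in> carrier_mat q p"
    and comm: "W * A = B * W" and disj: "spectrum A \<inter> spectrum B = {}"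
  shows "W = 0\<^sub>m q p"
proof -
  obtain es where cp: "char_poly A = (\<Prod>e\<leftarrow>es. [:- e, 1:])"
    using char_poly_factorized[OF A] by blast
  obtain T P Q where "schur_decomposition A es = (T, P, Q)"
    by (cases "schur_decomposition A es")
  from schur_decomposition[OF A cp this]
  have sim: "similar_mat_wit A T P Q" and ut: "upper_triangular T" and diag: "diag_mat T = es"
    by auto
  note S = similar_mat_witD2[OF A sim]
  define V where "V = W * P"
  have V: "V \<in> carrier_mat q p" using W S unfolding V_def by simp
  have "A * P = P * T" using S by (simp add: S(3) mult_assoc_dim)
  then have "V * T = W * A * P" using A W S(4-7) by (simp add: V_def mult_assoc_dim)
  then have VT: "V * T = B * V" using B W S(4-7) by (simp add: comm V_def mult_assoc_dim)
  have "col V j = 0\<^sub>v q" if "j < p" for j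
    using that
  proof (induction j rule: less_induct)
    case (less j)
    have eig: "B *\<^sub>v col V j = T $$ (j, j) \<cdot>\<^sub>v col V j"
    proof (rule eq_vecI)
      fix i assume "i < dim_vec (T $$ (j, j) \<cdot>\<^sub>v col V j)"
      then have i: "i < q" using V by simp
      have V0: "V $$ (i, k) = 0" if "k < j" for k
        using less.IH[OF that] less.prems that i V index_col[of i V k] by auto
      have "(B *\<^sub>v col V j) $ i = (V * T) $$ (i, j)"
        using VT B V i less.prems by simp
      also have "\<dots> = (\<Sum>k<p. V $$ (i, k) * T $$ (k, j))"
        using V S i less.prems by (simp add: scalar_prod_def atLeast0LessThan)
      also have "\<dots> = (\<Sum>k\<in>{j}. V $$ (i, k) * T $$ (k, j))"
      proof (rule sum.mono_neutral_right)
        show "\<forall>k\<in>{..<p} - {j}. V $$ (i, k) * T $$ (k, j) = 0"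
        proof
          fix k assume "k \<in> {..<p} - {j}"
          then consider "k < j" | "j < k" "k < p" by force
          then show "V $$ (i, k) * T $$ (k, j) = 0"
            using V0 upper_triangularD[OF ut] S by cases auto
        qed
      qed (use less.prems in auto)
      finally show "(B *\<^sub>v col V j) $ i = (T $$ (j, j) \<cdot>\<^sub>v col V j) $ i"
        using V i less.prems by simp
    qed (use B V in auto)
    have "T $$ (j, j) \<in> set es"
      using diag S less.prems unfolding diag_mat_def by auto
    then have "T $$ (j, j) \<in> spectrum A"
      unfolding spectrum_root_char_poly[OF A] cp by (force simp: poly_prod_list prod_list_zero_iff)
    then have "\<not> eigenvector B (col V j) (T $$ (j, j))"
      using disj unfolding spectrum_def eigenvalue_def by auto
    then show ?case
      using eig B V by (auto simp: eigenvector_def)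
  qed
  then have V0: "V = 0\<^sub>m q p"
    using V by (intro mat_col_eqI) auto
  have "W = V * Q" using W S by (simp add: V_def mult_assoc_dim)
  then show ?thesis using V0 S by simp
qed

section \<open>Inverse matrices and residuals of deflating pairs\<close>

lemma the_mat_inverse:
  fixes G :: "complex mat"
  assumes G: "G \<in> carrier_mat p p" and inv: "invertible_mat G"
  shows "the (mat_inverse G) \<in> carrier_mat p p"
    "G * the (mat_inverse G) = 1\<^sub>m p" "the (mat_inverse G) * G = 1\<^sub>m p"
proof -
  obtain B where B: "inverts_mat G B" "inverts_mat B G"
    using inv unfolding invertible_mat_def by auto
  then have GB: "G * B = 1\<^sub>m p" "B * G = 1\<^sub>m (dim_row B)"
    using G unfolding inverts_mat_def by auto
  have "dim_row B = p" "dim_col B = p"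
    using arg_cong[OF GB(1), of dim_col] arg_cong[OF GB(2), of dim_col] G by auto
  then have "G \<in> Units (ring_mat TYPE(complex) p ())"
    using G GB by (auto simp: Units_def ring_mat_simps intro!: bexI[of _ B])
  then obtain C where "mat_inverse G = Some C"
    using mat_inverse(1)[OF G, of "()"] by (cases "mat_inverse G") auto
  then show "the (mat_inverse G) \<in> carrier_mat p p"
    "G * the (mat_inverse G) = 1\<^sub>m p" "the (mat_inverse G) * G = 1\<^sub>m p"
    using mat_inverse(2)[OF G] by auto
qed

lemma eq_uminus_if_add_eq_zero_mat:
  fixes A B :: "complex mat"
  assumes "A \<in> carrier_mat a b" "B \<in> carrier_mat a b" "A + B = 0\<^sub>m a b"
  shows "A = - B"
proof (rule eq_matI)
  fix i j assume ij: "i < dim_row (- B)" "j < dim_col (- B)"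
  have "(A + B) $$ (i, j) = 0" unfolding assms(3) using assms(2) ij by simp
  then have "A $$ (i, j) + B $$ (i, j) = 0" using ij by simp
  then show "A $$ (i, j) = (- B) $$ (i, j)"
    using assms(1,2) ij by (simp add: add_eq_0_iff2)
qed (use assms in auto)

lemma deflating_pair_left_mult:
  fixes S :: "complex mat"
  assumes S: "S \<in> carrier_mat N N" and defl: "deflating_pair N p (M, K) (X, L)"
  shows "S * M * X * L = - (S * K * X)"
proof (rule eq_uminus_if_add_eq_zero_mat)
  have c: "M \<in> carrier_mat N N" "K \<in> carrier_mat N N" "X \<in> carrier_mat N p" "L \<in> carrier_mat p p"
    and eq: "M * X * L + K * X = 0\<^sub>m N p"
    using defl by auto
  show "S * M * X * L \<in> carrier_mat N p" "S * K * X \<in> carrier_mat N p" using S c by auto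
  have "S * M * X * L + S * K * X = S * (M * X * L) + S * (K * X)"
    using S c by (simp add: mult_assoc_dim)
  also have "\<dots> = S * (M * X * L + K * X)"
    by (rule mult_add_distrib_mat[symmetric]) (use S c in auto)
  also have "\<dots> = 0\<^sub>m N p" unfolding eq using S by simp
  finally show "S * M * X * L + S * K * X = 0\<^sub>m N p" .
qed

section \<open>Deflating pairs of structured pencils\<close>

context mat_star
begin

lemma star_congruence:
  assumes "A \<in> carrier_mat N N" "X \<in> carrier_mat N p"
  shows "star (star X * A * X) = star X * star A * X"
  using assms by (simp add: star_mult mult_assoc_dim)

text \<open>Applying \<open>star\<close> to the equation for \<open>Y\<close> and using the symmetries of \<open>A\<close> and \<open>B\<close> gives
  \<open>star R * (star Y * A) = star Y * B\<close>. Eliminating \<open>star Y * B * X\<close> with the equation for \<open>X\<close> leaves a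
  homogeneous Sylvester equation for \<open>star Y * A * X\<close>.\<close>

lemma deflating_orthogonal:
  assumes c: "A \<in> carrier_mat N N" "B \<in> carrier_mat N N" "X \<in> carrier_mat N p" "Y \<in> carrier_mat N q"
      "L \<in> carrier_mat p p" "R \<in> carrier_mat q q"
    and skew: "star A = - A" and sym: "star B = B"
    and X: "A * X * L = - (B * X)" and Y: "A * Y * R = - (B * Y)"
    and disj: "spectrum L \<inter> spectrum (- star R) = {}"
  shows "star Y * A * X = 0\<^sub>m q p"
proof (rule sylvester_homogeneous_zero[OF _ _ _ _ disj])
  have "star (A * Y * R) = - (star R * (star Y * A))"
    using c by (simp add: star_mult skew mult_assoc_dim)
  moreover have "star (A * Y * R) = - (star Y * B)"
    using c by (simp add: Y star_mult star_uminus sym)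
  ultimately have Y': "star R * (star Y * A) = star Y * B" by (metis uminus_uminus_mat)
  have "star Y * A * X * L = star Y * (A * X * L)" using c by (simp add: mult_assoc_dim)
  also have "\<dots> = - (star Y * B * X)" using c by (simp add: X mult_assoc_dim)
  also have "\<dots> = - star R * (star Y * A * X)"
    using c by (simp add: Y'[symmetric] mult_assoc_dim)
  finally show "star Y * A * X * L = - star R * (star Y * A * X)" .
qed (use c in auto)

text \<open>The equation for \<open>X\<close> rewrites the product as \<open>- (star X * B * X)\<close>, a congruence of a symmetric
  matrix.\<close>

lemma projected_product_symmetric:
  assumes c: "A \<in> carrier_mat N N" "B \<in> carrier_mat N N" "X \<in> carrier_mat N p" "L \<in> carrier_mat p p"
    and sym: "star B = B" and X: "A * X * L = - (B * X)"
  shows "star (star X * A * X * L) = star X * A * X * L"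
proof -
  have "star X * A * X * L = star X * (A * X * L)" using c by (simp add: mult_assoc_dim)
  also have "\<dots> = - (star X * B * X)" using c by (simp add: X mult_assoc_dim)
  finally show ?thesis using c by (simp add: star_uminus star_congruence sym)
qed

section \<open>Structured low-rank updates\<close>

lemma J_unitary: "star (J_mat n) * J_mat n = 1\<^sub>m (2 * n)" "J_mat n * star (J_mat n) = 1\<^sub>m (2 * n)"
  using J_carrier[of n] by (simp_all add: star_J J_square)

lemma J_mult_update:
  assumes "U \<in> carrier_mat (2 * n) p" "Z \<in> carrier_mat p p"
  shows "J_mat n * (star (J_mat n) * U * Z * star U) = U * Z * star U"
proof -
  have "J_mat n * (star (J_mat n) * U * Z * star U) = J_mat n * star (J_mat n) * U * Z * star U"
    using assms J_carrier[of n] by (simp add: mult_assoc_dim)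
  then show ?thesis using assms by (simp add: J_unitary)
qed

text \<open>\<open>star J\<close> is the inverse of \<open>J\<close>, so multiplication by \<open>J\<close> removes it from the updates and leaves
  congruences of \<open>Mh\<close> and \<open>Kh\<close>, which inherit their symmetry.\<close>

lemma SHH_update:
  assumes SHH: "SHH_pencil star n (M, K)" and U: "U \<in> carrier_mat (2 * n) p"
    and small: "(Mh, Kh) \<in> structured_pencils p star"
  shows "SHH_pencil star n
    (M + star (J_mat n) * U * Mh * star U, K + star (J_mat n) * U * Kh * star U)"
proof -
  have c: "M \<in> carrier_mat (2 * n) (2 * n)" "K \<in> carrier_mat (2 * n) (2 * n)"
      "Mh \<in> carrier_mat p p" "Kh \<in> carrier_mat p p"
    and big: "star (J_mat n * M) = - (J_mat n * M)" "star (J_mat n * K) = J_mat n * K"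
    and sm: "star Mh = - Mh" "star Kh = Kh"
    using SHH small by (auto simp: structured_pencils_def)
  note J = J_carrier[of n]
  let ?N = "\<lambda>A Z. A + star (J_mat n) * U * Z * star U"
  have JN: "J_mat n * ?N A Z = J_mat n * A + U * Z * star U"
    if "A \<in> carrier_mat (2 * n) (2 * n)" "Z \<in> carrier_mat p p" for A Z
    unfolding J_mult_update[OF U that(2), symmetric]
    by (rule mult_add_distrib_mat) (use J U that in auto)
  have UZ: "star (U * Z * star U) = U * star Z * star U" if "Z \<in> carrier_mat p p" for Z
    using U that by (simp add: star_mult mult_assoc_dim)
  have "star (J_mat n * ?N M Mh) = - (J_mat n * M) + - (U * Mh * star U)"
    using c U J by (simp add: JN UZ star_add big sm)
  also have "\<dots> = - (J_mat n * ?N M Mh)"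
    using c U J by (simp add: JN) (rule eq_matI, auto)
  finally have 1: "star (J_mat n * ?N M Mh) = - (J_mat n * ?N M Mh)" .
  have 2: "star (J_mat n * ?N K Kh) = J_mat n * ?N K Kh"
    using c U J by (simp add: JN UZ star_add big sm)
  show ?thesis using 1 2 c U J by auto
qed

lemma low_rank_update_mult:
  assumes c: "A \<in> carrier_mat N N" "V \<in> carrier_mat N p" "Z \<in> carrier_mat p p"
      "U \<in> carrier_mat N p" "Y \<in> carrier_mat N r"
  shows "A + V * Z * star U \<in> carrier_mat N N"
    and "(A + V * Z * star U) * Y = A * Y + V * Z * (star U * Y)"
proof -
  show "A + V * Z * star U \<in> carrier_mat N N" using c by (intro carrier_matI) auto
  have "(A + V * Z * star U) * Y = A * Y + V * Z * star U * Y"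
    by (rule add_mult_distrib_mat) (use c in auto)
  then show "(A + V * Z * star U) * Y = A * Y + V * Z * (star U * Y)"
    using c by (simp add: mult_assoc_dim)
qed

text \<open>An update that acts through \<open>star U\<close> cannot be seen on the kernel of \<open>star U\<close>.\<close>

lemma deflating_pair_preserved:
  assumes defl: "deflating_pair N q (M, K) (Y, R)"
    and c: "V \<in> carrier_mat N p" "U \<in> carrier_mat N p" "Mh \<in> carrier_mat p p" "Kh \<in> carrier_mat p p"
    and orth: "star U * Y = 0\<^sub>m p q"
  shows "deflating_pair N q (M + V * Mh * star U, K + V * Kh * star U) (Y, R)"
proof -
  have d: "M \<in> carrier_mat N N" "K \<in> carrier_mat N N" "Y \<in> carrier_mat N q" "R \<in> carrier_mat q q"
    using defl by auto
  have "(A + V * Z * star U) * Y = A * Y"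
    if "A \<in> carrier_mat N N" "Z \<in> carrier_mat p p" for A Z
    using low_rank_update_mult(2)[OF that(1) c(1) that(2) c(2) d(3)] c d that by (simp add: orth)
  then show ?thesis
    using defl low_rank_update_mult(1)[OF _ c(1) _ c(2) d(3)] c d by simp
qed

text \<open>On \<open>X\<close> the factor \<open>star U\<close> acts as the identity, so the update adds \<open>V * Mh\<close> to \<open>M * X\<close> and
  \<open>V * Kh\<close> to \<open>K * X\<close>. The new residual is therefore \<open>M * X * La + K * X + V * (Mh * La + Kh)\<close>, and
  the equation for \<open>Mh\<close> and \<open>Kh\<close> is what turns the last summand into \<open>M * X * (L - La)\<close>, so that
  the old residual reappears.\<close>

lemma deflating_pair_replaced:
  assumes defl: "deflating_pair N p (M, K) (X, L)" and La: "La \<in> carrier_mat p p"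
    and c: "V \<in> carrier_mat N p" "U \<in> carrier_mat N p" "Mh \<in> carrier_mat p p" "Kh \<in> carrier_mat p p"
      "G \<in> carrier_mat p p"
    and dual: "star U * X = 1\<^sub>m p" and VG: "V * G = M * X"
    and eq: "Mh * La + Kh = G * (L - La)"
  shows "deflating_pair N p (M + V * Mh * star U, K + V * Kh * star U) (X, La)"
proof -
  have d: "M \<in> carrier_mat N N" "K \<in> carrier_mat N N" "X \<in> carrier_mat N p" "L \<in> carrier_mat p p"
    and res: "M * X * L + K * X = 0\<^sub>m N p"
    using defl by auto
  have upd: "(A + V * Z * star U) * X = A * X + V * Z"
    if "A \<in> carrier_mat N N" "Z \<in> carrier_mat p p" for A Z
    using low_rank_update_mult(2)[OF that(1) c(1) that(2) c(2) d(3)] c that by (simp add: dual)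
  have "V * Mh * La + V * Kh = V * (Mh * La + Kh)"
    using c La by (simp add: mult_assoc_dim mult_add_distrib_mat[of V N p _ p])
  also have "\<dots> = V * G * (L - La)"
    using c d La by (simp add: eq mult_assoc_dim)
  also have "\<dots> = M * X * L - M * X * La"
    unfolding VG by (rule mult_minus_distrib_mat) (use d La in auto)
  finally have corr: "V * Mh * La + V * Kh = M * X * L - M * X * La" .
  have "(M + V * Mh * star U) * X * La + (K + V * Kh * star U) * X
      = (M * X + V * Mh) * La + (K * X + V * Kh)"
    using c d by (simp add: upd)
  also have "(M * X + V * Mh) * La = M * X * La + V * Mh * La"
    by (rule add_mult_distrib_mat) (use c d La in auto)
  also have "M * X * La + V * Mh * La + (K * X + V * Kh)
      = M * X * La + K * X + (V * Mh * La + V * Kh)"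
    by (rule eq_matI) (use c d La in auto)
  also have "\<dots> = M * X * L + K * X"
    unfolding corr by (rule eq_matI) (use c d La in auto)
  also have "\<dots> = 0\<^sub>m N p" by (rule res)
  finally have "(M + V * Mh * star U) * X * La + (K + V * Kh * star U) * X = 0\<^sub>m N p" .
  then show ?thesis
    using defl low_rank_update_mult(1)[OF _ c(1) _ c(2) d(3)] c La by simp
qed

text \<open>The defining equation rearranges to \<open>Kh + (Mh + G) * La = G * L\<close>. If two matrices add up to a
  \<open>star\<close>-symmetric one, then they are \<open>star\<close>-symmetric together or not at all.\<close>

lemma structured_pencils_substitute:
  assumes c: "Mh \<in> carrier_mat p p" "Kh \<in> carrier_mat p p" "G \<in> carrier_mat p p"
      "L \<in> carrier_mat p p" "La \<in> carrier_mat p p"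
    and eq: "Mh * La + Kh = G * (L - La)" and sym: "star (G * L) = G * L"
  shows "(Mh, Kh) \<in> structured_pencils p star \<longleftrightarrow> (Mh, (Mh + G) * La) \<in> structured_pencils p star"
proof -
  define B where "B = (Mh + G) * La"
  have B: "B \<in> carrier_mat p p" unfolding B_def using c by (intro carrier_matI) auto
  have "B = Mh * La + G * La"
    unfolding B_def by (rule add_mult_distrib_mat) (use c in auto)
  then have "Kh + B = Mh * La + Kh + G * La"
    by (intro eq_matI) (use c in auto)
  also have "\<dots> = G * L - G * La + G * La"
    unfolding eq using c by (simp add: mult_minus_distrib_mat[of G p p])
  also have "\<dots> = G * L" by (rule eq_matI) (use c in auto)
  finally have sum: "Kh + B = G * L" .
  have KB: "Kh = G * L - B" "B = G * L - Kh"
    unfolding sum[symmetric] by (rule eq_matI; use c B in auto)+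
  have "star Kh = Kh \<longleftrightarrow> star B = B"
  proof
    assume "star Kh = Kh"
    then have "star (G * L - Kh) = G * L - Kh" using c by (simp add: star_diff sym)
    then show "star B = B" unfolding KB(2)[symmetric] .
  next
    assume "star B = B"
    then have "star (G * L - B) = G * L - B" using c B by (simp add: star_diff sym)
    then show "star Kh = Kh" unfolding KB(1)[symmetric] .
  qed
  then show ?thesis
    using c B unfolding structured_pencils_def B_def[symmetric] by simp
qed

end

section \<open>Replacing the eigenvalues of one deflating pair\<close>

theorem proposition7p1:
  fixes star :: "complex mat \<Rightarrow> complex mat"
    and n p q :: nat
    and M K X\<^sub>c \<Lambda>\<^sub>c X\<^sub>f \<Lambda>\<^sub>f \<Lambda>\<^sub>a Mh Kh G U \<Delta>M \<Delta>K :: "complex mat"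
  assumes "star \<in> {mat_adjoint, transpose_mat}"
    and "SHH_pencil star n (M, K)"
    and "regular_pencil (M, K)"
    and "complementary_deflating_pairs (2 * n) p q (M, K) (X\<^sub>c, \<Lambda>\<^sub>c) (X\<^sub>f, \<Lambda>\<^sub>f)"
    and "spectrum \<Lambda>\<^sub>c \<inter> spectrum (- star \<Lambda>\<^sub>f) = {}"
    and "G = star X\<^sub>c * J_mat n * M * X\<^sub>c"
    and "invertible_mat G"
    and "\<Lambda>\<^sub>a \<in> carrier_mat p p" "Mh \<in> carrier_mat p p" "Kh \<in> carrier_mat p p"
    and "Mh * \<Lambda>\<^sub>a + Kh = G * (\<Lambda>\<^sub>c - \<Lambda>\<^sub>a)"
    and "U = J_mat n * M * X\<^sub>c * the (mat_inverse G)"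
    and "\<Delta>M = star (J_mat n) * U * Mh * star U"
    and "\<Delta>K = star (J_mat n) * U * Kh * star U"
  shows "complementary_deflating_pairs (2 * n) p q (M + \<Delta>M, K + \<Delta>K) (X\<^sub>c, \<Lambda>\<^sub>a) (X\<^sub>f, \<Lambda>\<^sub>f)
    \<and> ((Mh, Kh) \<in> structured_pencils p star \<longrightarrow> SHH_pencil star n (M + \<Delta>M, K + \<Delta>K))
    \<and> ((Mh, Kh) \<in> structured_pencils p star \<longleftrightarrow>
        (Mh, (Mh + G) * \<Lambda>\<^sub>a) \<in> structured_pencils p star)"
proof -
  interpret mat_star star by unfold_locales (rule assms(1))
  let ?J = "J_mat n" and ?Gi = "the (mat_inverse G)"
  define A where "A = ?J * M"
  define B where "B = ?J * K"
  have dc: "deflating_pair (2 * n) p (M, K) (X\<^sub>c, \<Lambda>\<^sub>c)"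
    and df: "deflating_pair (2 * n) q (M, K) (X\<^sub>f, \<Lambda>\<^sub>f)"
    and nonsing: "invertible_mat (append_cols X\<^sub>c X\<^sub>f)"
    using assms(4) unfolding complementary_deflating_pairs_def by auto
  have c: "M \<in> carrier_mat (2 * n) (2 * n)" "K \<in> carrier_mat (2 * n) (2 * n)"
    "X\<^sub>c \<in> carrier_mat (2 * n) p" "\<Lambda>\<^sub>c \<in> carrier_mat p p"
    "X\<^sub>f \<in> carrier_mat (2 * n) q" "\<Lambda>\<^sub>f \<in> carrier_mat q q"
    using dc df by auto
  note J = J_carrier[of n]
  have AB: "A \<in> carrier_mat (2 * n) (2 * n)" "B \<in> carrier_mat (2 * n) (2 * n)"
    using J c by (auto simp: A_def B_def)
  have skew: "star A = - A" and sym: "star B = B"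
    using assms(2) by (auto simp: A_def B_def)
  have Xc: "A * X\<^sub>c * \<Lambda>\<^sub>c = - (B * X\<^sub>c)" and Xf: "A * X\<^sub>f * \<Lambda>\<^sub>f = - (B * X\<^sub>f)"
    unfolding A_def B_def using deflating_pair_left_mult[OF J] dc df by auto
  have G_eq: "G = star X\<^sub>c * A * X\<^sub>c"
    using c J by (simp add: assms(6) A_def mult_assoc_dim)
  have G: "G \<in> carrier_mat p p" unfolding G_eq using c AB by (intro carrier_matI) auto
  note Gi = the_mat_inverse[OF G assms(7)]
  have U_eq: "U = A * X\<^sub>c * ?Gi" by (simp add: assms(12) A_def)
  have U: "U \<in> carrier_mat (2 * n) p" using AB c Gi by (simp add: U_eq)
  have "star G = - G"
    using star_congruence[OF AB(1) c(3)] AB c by (simp add: G_eq skew)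
  \<comment> \<open>The inverse of a skew matrix is skew: \<open>- star ?Gi\<close> is a left inverse of \<open>G\<close>.\<close>
  have star_Gi: "star ?Gi = - ?Gi"
  proof -
    have "star ?Gi * G = - (star ?Gi * star G)" using \<open>star G = - G\<close> G Gi(1) by simp
    also have "star ?Gi * star G = 1\<^sub>m p"
      using G Gi star_mult[of G ?Gi] by (simp add: star_one)
    finally have "star ?Gi * G * ?Gi = - ?Gi" using Gi by simp
    moreover have "star ?Gi * G * ?Gi = star ?Gi" using G Gi by (simp add: mult_assoc_dim)
    ultimately show ?thesis by simp
  qed
  have star_U: "star U = ?Gi * (star X\<^sub>c * A)"
    using c AB Gi(1) by (simp add: U_eq star_mult skew star_Gi mult_assoc_dim)
  have dual: "star U * X\<^sub>c = 1\<^sub>m p"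
    using c AB Gi by (simp add: star_U mult_assoc_dim G_eq)
  have "star X\<^sub>f * A * X\<^sub>c = 0\<^sub>m q p"
    by (rule deflating_orthogonal[OF AB c(3,5,4,6) skew sym Xc Xf assms(5)])
  moreover have "star (star X\<^sub>f * A * X\<^sub>c) = - (star X\<^sub>c * A * X\<^sub>f)"
    using c AB by (simp add: star_mult skew mult_assoc_dim)
  ultimately have "- (star X\<^sub>c * A * X\<^sub>f) = 0\<^sub>m p q" by (simp add: star_zero)
  then have "star X\<^sub>c * A * X\<^sub>f = - 0\<^sub>m p q" by (metis uminus_uminus_mat)
  also have "\<dots> = 0\<^sub>m p q" by (rule eq_matI) auto
  finally have "star X\<^sub>c * A * X\<^sub>f = 0\<^sub>m p q" .
  then have orth: "star U * X\<^sub>f = 0\<^sub>m p q"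
    using c AB Gi(1) by (simp add: star_U mult_assoc_dim)
  have V: "star ?J * U \<in> carrier_mat (2 * n) p" using J U by (intro carrier_matI) auto
  have "star ?J * U * G = star ?J * ?J * (M * X\<^sub>c * (?Gi * G))"
    using c J Gi(1) G by (simp add: assms(12) mult_assoc_dim)
  also have "\<dots> = M * X\<^sub>c" using c Gi(3) by (simp add: J_unitary)
  finally have VG: "star ?J * U * G = M * X\<^sub>c" .
  have "complementary_deflating_pairs (2 * n) p q (M + \<Delta>M, K + \<Delta>K) (X\<^sub>c, \<Lambda>\<^sub>a) (X\<^sub>f, \<Lambda>\<^sub>f)"
    using deflating_pair_replaced[OF dc assms(8) V U assms(9,10) G dual VG assms(11)]
      deflating_pair_preserved[OF df V U assms(9,10) orth] nonsing
    unfolding complementary_deflating_pairs_def assms(13,14) by simp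
  moreover have "(Mh, Kh) \<in> structured_pencils p star \<longrightarrow> SHH_pencil star n (M + \<Delta>M, K + \<Delta>K)"
    unfolding assms(13,14) using SHH_update[OF assms(2) U] by blast
  moreover have "star (G * \<Lambda>\<^sub>c) = G * \<Lambda>\<^sub>c"
    unfolding G_eq by (rule projected_product_symmetric[OF AB c(3,4) sym Xc])
  then have "(Mh, Kh) \<in> structured_pencils p star \<longleftrightarrow>
      (Mh, (Mh + G) * \<Lambda>\<^sub>a) \<in> structured_pencils p star"
    by (rule structured_pencils_substitute[OF assms(9,10) G c(4) assms(8,11)])
  ultimately show ?thesis by blast
qed

end
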